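(* Let $p$ be a prime, $q=p^s$, $A=\mathbb{F}_q[t]$, $K=\mathbb{F}_q(t)$. Let $a,b\in\mathbb{Z}_+$ with $a\ge b\ge1$ and let $m$ be the smallest nonnegative integer with $a\le p^m$. Then $$\Delta(a,b)=\sum_{i=0}^{a-1}f_iS_1(a-i),$$ where $f(t)=f_0+f_1t+\dots+f_{a-1}t^{a-1}\in\mathbb{F}_p[t]$ is the unique polynomial of degree $<a$ congruent modulo $t^a$ to $$-\left(t^{q-1}-1\right)^{p^m-a}\sum_{\theta\in\mathbb{F}_q}\sum_{\mu\in\mathbb{F}_q^*}\left(\sum_{j=1}^{q-1}\mu^{q-1-j}(t+\theta)^{j-1}\right)^a(t+\theta-\mu)^{a-b}.$$ Equivalently, $f(t)$ equals $$\sum_{i_3=0}^{p^m-a}\sum_{k}\sum_{i_1=0}^{a-b}\sum_{i_2=0}^{\sigma(k)+i_1-1}\binom{p^m-a}{i_3}\binom{a}{k_1,\dots,k_{q-1}}\binom{a-b}{i_1}\binom{\sigma(k)+i_1}{i_2}(-1)^{b+i_1+i_3}\,t^{\,i_2+i_3(q-1)},$$ where the second sum is over all $(q-1)$-tuples $k=(k_1,\dots,k_{q-1})$ of nonnegative integers with $k_1+\dots+k_{q-1}=a$, $\sigma(k)=\sum_{j=2}^{q-1}(j-1)k_j$, $\tau(k)=\sum_{j=1}^{q-2}(q-1-j)k_j$, and the indices are restricted to those with $\sigma(k)+i_1-i_2$ and $\tau(k)+a-b-i_1$ both divisible by $q-1$ and $i_2+i_3(q-1)<a$.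
   Context: For $s\in\mathbb{Z}$, $S_1(s)=\sum_n n^{-s}\in K$, summed over all monic $n\in A$ of degree $1$. For $a,b\in\mathbb{Z}_+$, $\Delta(a,b)=S_1(a)S_1(b)-S_1(a+b)$. The multinomial coefficient $\binom{a}{k_1,\dots,k_{q-1}}=a!/(k_1!\cdots k_{q-1}!)$, all integer coefficients being read in $\mathbb{F}_p$. *)

theory Defs
  imports
    "HOL-Computational_Algebra.Computational_Algebra"
    "HOL-Number_Theory.Cong"
    "HOL-Library.FuncSet"
begin

(* The type 'a plays the role of F_q; A = 'a poly and K = 'a poly fract. *)

definition S1 :: "int \<Rightarrow> 'a::finite_field poly fract" where
  "S1 k = (\<Sum>n | lead_coeff n = 1 \<and> degree n = 1. to_fract n powi (- k))"

definition Delta :: "nat \<Rightarrow> nat \<Rightarrow> 'a::finite_field poly fract" where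
  "Delta a b = S1 (int a) * S1 (int b) - S1 (int (a + b))"

(* F_p is the prime subfield of F_q, i.e. the image \<int> of the integers in 'a. *)
definition prime_subfield_polys :: "'a::finite_field poly set" where
  "prime_subfield_polys = {f. \<forall>i. coeff f i \<in> \<int>}"

(* Here [:\<theta>, 1:] is t + \<theta>. *)
definition gen_poly :: "nat \<Rightarrow> nat \<Rightarrow> nat \<Rightarrow> nat \<Rightarrow> nat \<Rightarrow> 'a::finite_field poly" where
  "gen_poly p q m a b =
     - ((monom 1 (q - 1) - 1) ^ (p ^ m - a) *
        (\<Sum>\<theta>\<in>(UNIV :: 'a set). \<Sum>\<mu>\<in>UNIV - {0}.
           (\<Sum>j=1..q-1. smult (\<mu> ^ (q - 1 - j)) ([:\<theta>, 1:] ^ (j - 1))) ^ a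
           * [:\<theta> - \<mu>, 1:] ^ (a - b)))"

definition compositions :: "nat \<Rightarrow> nat \<Rightarrow> (nat \<Rightarrow> nat) set" where
  "compositions q a = {k \<in> {1..q-1} \<rightarrow>\<^sub>E UNIV. (\<Sum>j=1..q-1. k j) = a}"

lemma finite_compositions: "finite (compositions q a)"
proof (rule finite_subset)
  show "compositions q a \<subseteq> {1..q-1} \<rightarrow>\<^sub>E {..a}"
  proof
    fix k assume k: "k \<in> compositions q a"
    have "k j \<le> a" if "j \<in> {1..q-1}" for j
      using k member_le_sum[of j "{1..q-1}" k] that by (auto simp: compositions_def)
    with k show "k \<in> {1..q-1} \<rightarrow>\<^sub>E {..a}"
      by (auto simp: compositions_def PiE_iff)
  qed
  show "finite ({1..q-1} \<rightarrow>\<^sub>E {..a})"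
    by (intro finite_PiE) auto
qed

definition multinom :: "nat \<Rightarrow> nat \<Rightarrow> (nat \<Rightarrow> nat) \<Rightarrow> nat" where
  "multinom q a k = fact a div (\<Prod>j=1..q-1. fact (k j))"

definition sigma :: "nat \<Rightarrow> (nat \<Rightarrow> nat) \<Rightarrow> nat" where
  "sigma q k = (\<Sum>j=2..q-1. (j - 1) * k j)"

definition tau :: "nat \<Rightarrow> (nat \<Rightarrow> nat) \<Rightarrow> nat" where
  "tau q k = (\<Sum>j=1..q-2. (q - 1 - j) * k j)"

(* The range 0 .. sigma + i1 - 1 of i2 is empty when sigma + i1 = 0; it is therefore
   written i2 < sigma + i1, avoiding truncated subtraction. *)
definition expl_poly :: "nat \<Rightarrow> nat \<Rightarrow> nat \<Rightarrow> nat \<Rightarrow> nat \<Rightarrow> 'a::finite_field poly" where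
  "expl_poly p q m a b =
     (\<Sum>i3=0..p^m - a. \<Sum>k\<in>compositions q a. \<Sum>i1=0..a - b.
        \<Sum>i2 | i2 < sigma q k + i1
            \<and> (q - 1) dvd (sigma q k + i1 - i2)
            \<and> (q - 1) dvd (tau q k + (a - b - i1))
            \<and> i2 + i3 * (q - 1) < a.
          monom (of_nat ((p^m - a) choose i3) * of_nat (multinom q a k)
                 * of_nat ((a - b) choose i1) * of_nat ((sigma q k + i1) choose i2)
                 * (-1) ^ (b + i1 + i3))
            (i2 + i3 * (q - 1)))"

end

theory Submission
  imports Defs
begin

text \<open>
  Write \<open>P = t\<^sup>q - t\<close>, which is invariant under all shifts \<open>t \<mapsto> t + \<theta>\<close> and satisfies
  \<open>P = (t + \<theta>) ((t + \<theta>)\<^sup>q\<^sup>-\<^sup>1 - 1)\<close>. The inner sum over \<open>j\<close> is the geometric sum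
  \<open>((t + \<theta>)\<^sup>q\<^sup>-\<^sup>1 - 1) / (t + \<theta> - \<mu>)\<close>, so the double sum over \<open>\<theta>, \<mu>\<close> equals \<open>P\<^sup>a \<Delta>(a, b)\<close>.
  The \<open>p\<^sup>m\<close>-th power of \<open>t\<^sup>q\<^sup>-\<^sup>1 - 1\<close> is \<open>-1\<close> modulo \<open>t\<^sup>a\<close>, so the outer factor undoes the
  factor \<open>(t\<^sup>q\<^sup>-\<^sup>1 - 1)\<^sup>a\<close> of \<open>P\<^sup>a\<close>; hence \<open>f\<close> describes the principal part of \<open>\<Delta>(a, b)\<close> at \<open>t = 0\<close>.
  By shift invariance all other principal parts are translates of this one. Concretely, the
  difference of the two sides, multiplied by \<open>P\<^sup>a\<close>, is a shift-invariant polynomial divisible by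
  \<open>t\<^sup>a\<close>, hence by \<open>P\<^sup>a\<close>, and of degree less than \<open>q a\<close>, so it vanishes. The explicit formula is the
  multinomial expansion together with the values of power sums over a finite field.
\<close>

section \<open>The multinomial theorem over extensional functions\<close>

text \<open>Guarantees that the \<open>div\<close> in a multinomial coefficient is exact, so that
  these quotients can be multiplied and split like true quotients.\<close>

lemma prod_fact_dvd_fact_sum:
  assumes "finite I"
  shows "(\<Prod>j\<in>I. fact (k j) :: nat) dvd fact (\<Sum>j\<in>I. k j)"
  using assms
proof (induction I rule: finite_induct)
  case (insert i I)
  have "fact (k i) * (\<Prod>j\<in>I. fact (k j) :: nat) dvd fact (k i) * fact (\<Sum>j\<in>I. k j)"
    using insert.IH by (intro mult_dvd_mono) auto
  also have "\<dots> dvd fact (k i + (\<Sum>j\<in>I. k j))"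
    by (rule fact_fact_dvd_fact)
  finally show ?case using insert.hyps by simp
qed simp

text \<open>Induction on the index set: the binomial theorem splits off \<open>c i\<close> with
  exponent \<open>r\<close>, and the induction hypothesis expands the remaining sum to the power
  \<open>n - r\<close>. The multinomial coefficient factors accordingly as \<open>n choose r\<close>
  times a smaller one.\<close>

lemma sum_power_multinomial:
  fixes c :: "'i \<Rightarrow> 'a::comm_semiring_1"
  assumes "finite I"
  shows "(\<Sum>i\<in>I. c i) ^ n =
    (\<Sum>k | k \<in> I \<rightarrow>\<^sub>E UNIV \<and> (\<Sum>i\<in>I. k i) = n.
        of_nat (fact n div (\<Prod>i\<in>I. fact (k i))) * (\<Prod>i\<in>I. c i ^ k i))"
  using assms
proof (induction I arbitrary: n rule: finite_induct)
  case empty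
  have "{k. k \<in> {} \<rightarrow>\<^sub>E (UNIV :: nat set) \<and> (\<Sum>i\<in>{}. k i) = n}
      = (if n = 0 then {\<lambda>x::'i. undefined} else {})" by auto
  then show ?case by (simp add: power_0_left)
next
  case (insert i I)
  define T where "T N = {k. k \<in> I \<rightarrow>\<^sub>E (UNIV :: nat set) \<and> (\<Sum>i\<in>I. k i) = N}" for N
  define T' where "T' = {k. k \<in> insert i I \<rightarrow>\<^sub>E (UNIV :: nat set) \<and> (\<Sum>i\<in>insert i I. k i) = n}"
  have finT: "finite (T N)" for N
  proof (rule finite_subset)
    show "T N \<subseteq> I \<rightarrow>\<^sub>E {..N}"
    proof
      fix k assume k: "k \<in> T N"
      have "k j \<le> N" if "j \<in> I" for j
        using k member_le_sum[of j I k] that insert.hyps by (auto simp: T_def)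
      with k show "k \<in> I \<rightarrow>\<^sub>E {..N}" by (auto simp: T_def PiE_iff)
    qed
    show "finite (I \<rightarrow>\<^sub>E {..N})" using insert.hyps by (intro finite_PiE) auto
  qed
  have "(\<Sum>j\<in>insert i I. c j) ^ n = (c i + (\<Sum>j\<in>I. c j)) ^ n"
    using insert.hyps by simp
  also have "\<dots> = (\<Sum>r\<le>n. of_nat (n choose r) * c i ^ r * (\<Sum>j\<in>I. c j) ^ (n - r))"
    by (rule binomial_ring)
  also have "\<dots> = (\<Sum>r\<le>n. \<Sum>k\<in>T (n - r). of_nat (n choose r) * c i ^ r *
      (of_nat (fact (n - r) div (\<Prod>j\<in>I. fact (k j))) * (\<Prod>j\<in>I. c j ^ k j)))"
    unfolding insert.IH T_def by (simp add: sum_distrib_left)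
  also have "\<dots> = (\<Sum>(r, k)\<in>(SIGMA r:{..n}. T (n - r)). of_nat (n choose r) * c i ^ r *
      (of_nat (fact (n - r) div (\<Prod>j\<in>I. fact (k j))) * (\<Prod>j\<in>I. c j ^ k j)))"
    by (rule sum.Sigma) (use finT in auto)
  also have "\<dots> = (\<Sum>k\<in>T'. of_nat (fact n div (\<Prod>j\<in>insert i I. fact (k j)))
       * (\<Prod>j\<in>insert i I. c j ^ k j))"
  \<comment> \<open>A function on \<open>insert i I\<close> corresponds to its value
    \<open>r\<close> at \<open>i\<close> together with its restriction to \<open>I\<close>.
    Resetting the value at \<open>i\<close> to \<open>undefined\<close> makes this restriction
    extensional, as \<open>T\<close> requires.\<close>
  proof (rule sum.reindex_bij_witness[of _ "\<lambda>k. (k i, k(i := undefined))" "\<lambda>(r, k). k(i := r)"],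
         goal_cases)
    case (1 x)
    then obtain r k where x: "x = (r, k)" "r \<le> n" "k \<in> T (n - r)" by auto
    then have "k i = undefined" using insert.hyps by (auto simp: T_def PiE_iff extensional_def)
    with x show ?case by auto
  next
    case (2 x)
    then obtain r k where x: "x = (r, k)" "r \<le> n" "k \<in> T (n - r)" by auto
    have "(\<Sum>j\<in>I. (k(i := r)) j) = (\<Sum>j\<in>I. k j)"
      using insert.hyps by (intro sum.cong) auto
    with x insert.hyps show ?case
      by (auto simp: T_def T'_def PiE_iff extensional_def)
  next
    case (3 k)
    then show ?case by auto
  next
    case (4 k)
    have "(\<Sum>j\<in>I. (k(i := undefined)) j) = (\<Sum>j\<in>I. k j)"
      using insert.hyps by (intro sum.cong) auto
    with 4 insert.hyps show ?case
      by (auto simp: T_def T'_def PiE_iff extensional_def)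
  next
    case (5 x)
    then obtain r k where x: "x = (r, k)" "r \<le> n" "k \<in> T (n - r)" by auto
    have e: "(\<Prod>j\<in>I. fact ((k(i := r)) j)) = (\<Prod>j\<in>I. fact (k j) :: nat)"
            "(\<Prod>j\<in>I. c j ^ (k(i := r)) j) = (\<Prod>j\<in>I. c j ^ k j)"
      using insert.hyps by (auto intro!: prod.cong)
    have d: "(\<Prod>j\<in>I. fact (k j) :: nat) dvd fact (n - r)"
      using prod_fact_dvd_fact_sum[OF insert.hyps(1), of k] x by (auto simp: T_def)
    have "fact n = fact r * fact (n - r) * (n choose r)"
      using binomial_fact_lemma[OF x(2)] by simp
    with d have "fact n div (fact r * (\<Prod>j\<in>I. fact (k j) :: nat))
        = (n choose r) * (fact (n - r) div (\<Prod>j\<in>I. fact (k j)))"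
      by (auto elim!: dvdE simp: mult.assoc)
    then have "of_nat (fact n div (fact r * (\<Prod>j\<in>I. fact (k j) :: nat)))
        = of_nat (n choose r) * (of_nat (fact (n - r) div (\<Prod>j\<in>I. fact (k j))) :: 'a)"
      by simp
    then show ?case using insert.hyps x(1) by (simp add: e[unfolded fun_upd_apply] mult_ac)
  qed
  finally show ?case unfolding T'_def .
qed

section \<open>Power sums over a finite field\<close>

text \<open>The translation \<open>x + 1\<close> permutes the ring, so summing it over all
  \<open>x\<close> changes nothing, and the ones added must sum to 0.\<close>

lemma of_nat_card_UNIV_eq_0: "of_nat (card (UNIV :: 'a::{ring_1,finite} set)) = (0 :: 'a)"
proof -
  have "(\<Sum>x\<in>(UNIV :: 'a set). x + 1) = (\<Sum>x\<in>UNIV. x)"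
    by (rule sum.reindex_bij_witness[of _ "\<lambda>x. x - 1" "\<lambda>x. x + 1"]) auto
  then show ?thesis by (simp add: sum.distrib)
qed

text \<open>The characteristic is a prime, and it divides \<open>p ^ s\<close> because the number of
  elements is 0 in the field.\<close>

lemma CHAR_finite_field:
  assumes "prime p" "card (UNIV :: 'a::finite_field set) = p ^ s"
  shows "CHAR('a) = p"
proof -
  have "CHAR('a) dvd p ^ s"
    using of_nat_card_UNIV_eq_0[where 'a = 'a] assms(2) of_nat_eq_0_iff_char_dvd by metis
  moreover have "prime CHAR('a)" by (rule prime_CHAR_semidom) (rule CHAR_pos)
  ultimately show ?thesis
    using assms(1) by (metis prime_dvd_power primes_dvd_imp_eq)
qed

lemma card_finite_field_gt_1: "card (UNIV :: 'a::finite_field set) > 1"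
proof -
  have "card {0, 1 :: 'a} \<le> card (UNIV :: 'a set)" by (intro card_mono) auto
  then show ?thesis by simp
qed

lemma finite_field_power_card_minus_1:
  fixes x :: "'a::finite_field"
  assumes "x \<noteq> 0"
  shows "x ^ (card (UNIV :: 'a set) - 1) = 1"
proof -
  have "x * x ^ (card (UNIV :: 'a set) - 1) = x * 1"
    using finite_field_power_card_eq_same[of x] card_finite_field_gt_1[where 'a = 'a]
    by (metis mult.right_neutral power_minus_mult mult.commute order.strict_trans zero_less_one)
  then show ?thesis using assms by simp
qed

text \<open>If \<open>q - 1\<close> divides \<open>e\<close>, all summands are 1 and there are
  \<open>q - 1\<close> of them. Otherwise reduce \<open>e\<close> to its remainder \<open>r\<close>
  modulo \<open>q - 1\<close>: since \<open>t^r - 1\<close> has at most \<open>r < q - 1\<close>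
  roots, some nonzero \<open>g\<close> has \<open>g ^ r\<close> different from 1. Multiplication by
  \<open>g\<close> permutes the nonzero elements, so the sum equals \<open>g ^ r\<close> times
  itself and vanishes.\<close>

lemma sum_power_nonzero:
  fixes e :: nat
  shows "(\<Sum>x\<in>UNIV - {0 :: 'a::finite_field}. x ^ e)
      = (if (card (UNIV :: 'a set) - 1) dvd e then -1 else 0)"
proof (cases "(card (UNIV :: 'a set) - 1) dvd e")
  case True
  then obtain d where d: "e = (card (UNIV :: 'a set) - 1) * d" by (auto elim: dvdE)
  have "(\<Sum>x\<in>UNIV - {0 :: 'a}. x ^ e) = (\<Sum>x\<in>UNIV - {0 :: 'a}. 1)"
    by (intro sum.cong) (auto simp: d power_mult finite_field_power_card_minus_1 simp del: One_nat_def)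
  also have "\<dots> = of_nat (card (UNIV :: 'a set) - 1)" by (simp add: card_Diff_subset)
  also have "\<dots> = -1"
    using card_finite_field_gt_1[where 'a = 'a] by (simp add: of_nat_diff of_nat_card_UNIV_eq_0)
  finally show ?thesis using True by simp
next
  case False
  define n where "n = card (UNIV :: 'a set) - 1"
  define r where "r = e mod n"
  have n: "n > 0" using card_finite_field_gt_1[where 'a = 'a] by (simp add: n_def)
  have r: "0 < r" "r < n" using False n by (auto simp: r_def n_def mod_greater_zero_iff_not_dvd)
  have red: "x ^ e = x ^ r" if "x \<noteq> 0" for x :: 'a
  proof -
    have "x ^ e = x ^ (n * (e div n) + r)" by (simp add: r_def)
    also have "\<dots> = x ^ r"
      using finite_field_power_card_minus_1[OF that] by (simp add: power_add power_mult n_def)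
    finally show ?thesis .
  qed
  obtain g :: 'a where g: "g \<noteq> 0" "g ^ r \<noteq> 1"
  proof (rule ccontr)
    assume "\<not> thesis"
    with that have *: "x ^ r = 1" if "x \<noteq> 0" for x :: 'a using that by blast
    define P :: "'a poly" where "P = monom 1 r - 1"
    have "coeff P r = 1" using r by (simp add: P_def)
    then have "P \<noteq> 0" by auto
    have "card (UNIV - {0 :: 'a}) \<le> card {x. poly P x = 0}"
      by (intro card_mono) (auto simp: P_def poly_monom *)
    also have "\<dots> \<le> degree P" using \<open>P \<noteq> 0\<close> by (rule card_poly_roots_bound)
    also have "degree P \<le> r"
      unfolding P_def by (intro degree_diff_le) (auto simp: degree_monom_le)
    finally show False using r by (simp add: n_def card_Diff_subset)
  qed
  have "g ^ r * (\<Sum>x\<in>UNIV - {0 :: 'a}. x ^ r) = (\<Sum>x\<in>UNIV - {0 :: 'a}. (g * x) ^ r)"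
    by (simp add: sum_distrib_left power_mult_distrib)
  also have "\<dots> = (\<Sum>x\<in>UNIV - {0 :: 'a}. x ^ r)"
    by (rule sum.reindex_bij_witness[of _ "\<lambda>x. x / g" "\<lambda>x. g * x"]) (use g in auto)
  finally have "(\<Sum>x\<in>UNIV - {0 :: 'a}. x ^ r) = 0" using g by simp
  moreover have "(\<Sum>x\<in>UNIV - {0 :: 'a}. x ^ e) = (\<Sum>x\<in>UNIV - {0 :: 'a}. x ^ r)"
    by (intro sum.cong) (auto simp: red)
  ultimately show ?thesis using False by simp
qed

text \<open>The exponent 0 is exceptional: with \<open>0 ^ 0 = 1\<close> the sum counts all
  \<open>q\<close> elements and is 0 rather than -1.\<close>

lemma sum_power_UNIV:
  fixes e :: nat
  shows "(\<Sum>x\<in>(UNIV :: 'a::finite_field set). x ^ e)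
      = (if e > 0 \<and> (card (UNIV :: 'a set) - 1) dvd e then -1 else 0)"
proof (cases "e = 0")
  case True
  then show ?thesis by (simp add: of_nat_card_UNIV_eq_0)
next
  case False
  have "(\<Sum>x\<in>(UNIV :: 'a set). x ^ e) = 0 ^ e + (\<Sum>x\<in>UNIV - {0 :: 'a}. x ^ e)"
    by (rule sum.remove) auto
  then show ?thesis using False by (simp add: sum_power_nonzero)
qed

section \<open>Expansion of the double sum and the explicit polynomial\<close>

lemma linear_poly_power: "[:c, 1:] ^ n = (\<Sum>i\<le>n. monom (of_nat (n choose i) * c ^ (n - i)) i)"
  for c :: "'a::comm_ring_1"
proof -
  have "[:c, 1:] = monom 1 1 + [:c:]" by (simp add: monom_altdef)
  then have "[:c, 1:] ^ n = (\<Sum>i\<le>n. of_nat (n choose i) * monom 1 1 ^ i * [:c:] ^ (n - i))"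
    by (simp only: binomial_ring)
  also have "\<dots> = (\<Sum>i\<le>n. monom (of_nat (n choose i) * c ^ (n - i)) i)"
    by (intro sum.cong) (auto simp: monom_power poly_const_pow of_nat_poly smult_monom
          mult.commute )
  finally show ?thesis .
qed

text \<open>The coefficient of \<open>t^i\<close> is a binomial coefficient times the power sum of
  exponent \<open>n - i\<close>. The term \<open>i = n\<close> drops out since the power sum of
  exponent 0 vanishes; this is where the strict upper bound on \<open>i2\<close> in
  \<open>expl_poly\<close> comes from.\<close>

lemma sum_linear_poly_power:
  "(\<Sum>\<theta>\<in>(UNIV :: 'a::finite_field set). [:\<theta>, 1:] ^ n)
     = - (\<Sum>i | i < n \<and> (card (UNIV :: 'a set) - 1) dvd (n - i). monom (of_nat (n choose i)) i)"
proof -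
  let ?Q = "card (UNIV :: 'a set) - 1"
  have "(\<Sum>\<theta>\<in>(UNIV :: 'a set). [:\<theta>, 1:] ^ n)
      = (\<Sum>i\<le>n. \<Sum>\<theta>\<in>UNIV. monom (of_nat (n choose i) * \<theta> ^ (n - i)) i)"
    unfolding linear_poly_power by (rule sum.swap)
  also have "\<dots> = (\<Sum>i\<le>n. monom (of_nat (n choose i) * (\<Sum>\<theta>\<in>(UNIV :: 'a set). \<theta> ^ (n - i))) i)"
    by (simp add: sum_distrib_left flip: monom_sum)
  also have "\<dots> = (\<Sum>i\<le>n. if i < n \<and> ?Q dvd (n - i) then - monom (of_nat (n choose i)) i else 0)"
    unfolding sum_power_UNIV by (intro sum.cong) (auto simp: minus_monom)
  also have "\<dots> = (\<Sum>i\<in>{i\<in>{..n}. i < n \<and> ?Q dvd (n - i)}. - monom (of_nat (n choose i)) i)"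
    by (rule sum.inter_filter [symmetric]) auto
  also have "{i\<in>{..n}. i < n \<and> ?Q dvd (n - i)} = {i. i < n \<and> ?Q dvd (n - i)}" by auto
  finally show ?thesis by (simp add: sum_negf)
qed

lemma sum_smult_power_multinomial:
  fixes x :: "'a::comm_ring_1 poly"
  shows "(\<Sum>j=1..q-1. smult (\<mu> ^ (q - 1 - j)) (x ^ (j - 1))) ^ a
    = (\<Sum>k\<in>compositions q a. smult (of_nat (multinom q a k) * \<mu> ^ tau q k) (x ^ sigma q k))"
proof -
  have "(\<Prod>j=1..q-1. smult (\<mu> ^ (q - 1 - j)) (x ^ (j - 1)) ^ k j)
      = smult (\<mu> ^ tau q k) (x ^ sigma q k)" for k
  proof -
    \<comment> \<open>Both exponents are brought to the common range \<open>1..q-1\<close>; the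
      added terms, \<open>j = q - 1\<close> for \<open>tau\<close> and \<open>j = 1\<close> for
      \<open>sigma\<close>, carry the factor 0.\<close>
    have "tau q k = (\<Sum>j=1..q-1. (q - 1 - j) * k j)"
      unfolding tau_def by (rule sum.mono_neutral_left) auto
    moreover have "sigma q k = (\<Sum>j=1..q-1. (j - 1) * k j)"
      unfolding sigma_def by (rule sum.mono_neutral_left) auto
    ultimately show ?thesis
      by (simp add: smult_power prod_smult power_sum power_mult del: One_nat_def)
  qed
  then show ?thesis
    by (subst sum_power_multinomial)
       (auto simp: compositions_def multinom_def of_nat_poly mult.commute  intro!: sum.cong)
qed

lemma smult_sum_right: "smult c (\<Sum>i\<in>A. f i) = (\<Sum>i\<in>A. smult c (f i))"
  by (induction A rule: infinite_finite_induct) (auto simp: smult_add_right)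

lemma sum_swap3:
  "(\<Sum>x\<in>A. \<Sum>y\<in>B. \<Sum>z\<in>C. f x y z) = (\<Sum>z\<in>C. \<Sum>x\<in>A. \<Sum>y\<in>B. f x y z)"
  by (rule trans[OF sum.cong[OF refl sum.swap] sum.swap])

text \<open>Expanding \<open>t + \<theta> - \<mu>\<close> around \<open>t + \<theta>\<close> turns
  every term into a constant times a power of \<mu> times a power of \<open>t + \<theta>\<close>, so
  the sums over \<theta> and \<mu> separate. The two power sums produce the two divisibility
  conditions, and their minus signs cancel.\<close>

lemma double_sum_expansion:
  fixes q a d :: nat
  assumes q: "q = card (UNIV :: 'a::finite_field set)"
  shows "(\<Sum>\<theta>\<in>(UNIV :: 'a set). \<Sum>\<mu>\<in>UNIV - {0}.
           (\<Sum>j=1..q-1. smult (\<mu> ^ (q - 1 - j)) ([:\<theta>, 1:] ^ (j - 1))) ^ a * [:\<theta> - \<mu>, 1:] ^ d)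
    = (\<Sum>k\<in>compositions q a. \<Sum>i1=0..d. \<Sum>i2 | i2 < sigma q k + i1
            \<and> (q - 1) dvd (sigma q k + i1 - i2) \<and> (q - 1) dvd (tau q k + (d - i1)).
         monom (of_nat (multinom q a k) * of_nat (d choose i1)
           * of_nat ((sigma q k + i1) choose i2) * (-1) ^ (d - i1)) i2)"
proof -
  define C :: "(nat \<Rightarrow> nat) \<Rightarrow> nat \<Rightarrow> 'a" where
    "C k i = of_nat (multinom q a k) * of_nat (d choose i) * (-1) ^ (d - i)" for k i
  have shift: "[:\<theta> - \<mu>, 1:] ^ d =
      (\<Sum>i=0..d. smult (of_nat (d choose i) * (-1) ^ (d - i) * \<mu> ^ (d - i)) ([:\<theta>, 1:] ^ i))"
    for \<theta> \<mu> :: 'a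
  proof -
    have "[:\<theta> - \<mu>, 1:] = [:\<theta>, 1:] + [:-\<mu>:]" by simp
    then have "[:\<theta> - \<mu>, 1:] ^ d = (\<Sum>i\<le>d. of_nat (d choose i) * [:\<theta>, 1:] ^ i * [:-\<mu>:] ^ (d - i))"
      by (simp only: binomial_ring)
    also have "\<dots> = (\<Sum>i\<le>d. smult (of_nat (d choose i) * (-1) ^ (d - i) * \<mu> ^ (d - i)) ([:\<theta>, 1:] ^ i))"
      by (intro sum.cong refl)
         (simp add: poly_const_pow of_nat_poly power_minus[of \<mu>] mult_ac )
    finally show ?thesis by (simp add: atMost_atLeast0)
  qed
  have "(\<Sum>\<theta>\<in>(UNIV :: 'a set). \<Sum>\<mu>\<in>UNIV - {0}.
           (\<Sum>j=1..q-1. smult (\<mu> ^ (q - 1 - j)) ([:\<theta>, 1:] ^ (j - 1))) ^ a * [:\<theta> - \<mu>, 1:] ^ d)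
      = (\<Sum>\<theta>\<in>(UNIV :: 'a set). \<Sum>\<mu>\<in>UNIV - {0}. \<Sum>k\<in>compositions q a. \<Sum>i=0..d.
           smult (C k i * \<mu> ^ (tau q k + (d - i))) ([:\<theta>, 1:] ^ (sigma q k + i)))"
    unfolding sum_smult_power_multinomial shift sum_product
    by (intro sum.cong refl) (simp add: C_def power_add mult_ac del: Nat.add_diff_assoc)
  also have "\<dots> = (\<Sum>k\<in>compositions q a. \<Sum>i=0..d. \<Sum>\<theta>\<in>(UNIV :: 'a set). \<Sum>\<mu>\<in>UNIV - {0}.
           smult (C k i * \<mu> ^ (tau q k + (d - i))) ([:\<theta>, 1:] ^ (sigma q k + i)))"
    by (rule trans[OF sum_swap3 sum.cong[OF refl sum_swap3]])
  also have "\<dots> = (\<Sum>k\<in>compositions q a. \<Sum>i1=0..d. \<Sum>i2 | i2 < sigma q k + i1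
            \<and> (q - 1) dvd (sigma q k + i1 - i2) \<and> (q - 1) dvd (tau q k + (d - i1)).
         monom (of_nat (multinom q a k) * of_nat (d choose i1)
           * of_nat ((sigma q k + i1) choose i2) * (-1) ^ (d - i1)) i2)"
  proof (intro sum.cong refl)
    fix k i
    let ?N = "sigma q k + i" and ?e = "tau q k + (d - i)"
    have "(\<Sum>\<theta>\<in>(UNIV :: 'a set). \<Sum>\<mu>\<in>UNIV - {0}. smult (C k i * \<mu> ^ ?e) ([:\<theta>, 1:] ^ ?N))
        = smult (C k i * (\<Sum>\<mu>\<in>UNIV - {0}. \<mu> ^ ?e)) (\<Sum>\<theta>\<in>UNIV. [:\<theta>, 1:] ^ ?N)"
      by (simp only: smult_sum smult_sum_right sum_distrib_left)
    also have "\<dots> = (if (q - 1) dvd ?e then smult (C k i)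
        (\<Sum>i2 | i2 < ?N \<and> (q - 1) dvd (?N - i2). monom (of_nat (?N choose i2)) i2) else 0)"
      unfolding sum_power_nonzero sum_linear_poly_power q by simp
    also have "\<dots> = (\<Sum>i2 | i2 < ?N \<and> (q - 1) dvd (?N - i2) \<and> (q - 1) dvd ?e.
         monom (of_nat (multinom q a k) * of_nat (d choose i)
           * of_nat (?N choose i2) * (-1) ^ (d - i)) i2)"
      by (auto simp: smult_sum_right smult_monom C_def mult_ac intro!: sum.cong)
    finally show "(\<Sum>\<theta>\<in>(UNIV :: 'a set). \<Sum>\<mu>\<in>UNIV - {0}. smult (C k i * \<mu> ^ ?e) ([:\<theta>, 1:] ^ ?N))
       = (\<Sum>i2 | i2 < ?N \<and> (q - 1) dvd (?N - i2) \<and> (q - 1) dvd ?e.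
         monom (of_nat (multinom q a k) * of_nat (d choose i)
           * of_nat (?N choose i2) * (-1) ^ (d - i)) i2)" .
  qed
  finally show ?thesis .
qed

text \<open>Frobenius is applied to \<open>(x - 1) + 1\<close>, which avoids the sign of
  \<open>(-1) ^ (p ^ n)\<close> and hence a separate case \<open>p = 2\<close>.\<close>

lemma minus_one_power_prime_power:
  fixes p n :: nat
  assumes "prime p" "CHAR('a::comm_ring_1) = p"
  shows "(x - 1 :: 'a) ^ (p ^ n) = x ^ (p ^ n) - 1"
proof -
  have "(x - 1 + 1) ^ (p ^ n) = (x - 1) ^ (p ^ n) + 1 ^ (p ^ n)"
    by (rule freshmans_dream') (use assms in auto)
  then show ?thesis by simp
qed

text \<open>Expanding the outer factor as well gives the sum defining \<open>expl_poly\<close>, but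
  without the restriction to exponents below \<open>a\<close>; the monomials in excess are multiples
  of \<open>t^a\<close>.\<close>

lemma gen_poly_cong_expl_poly:
  fixes p s q a b m :: nat
  assumes p: "prime p" "q = p ^ s" and q: "card (UNIV :: 'a::finite_field set) = q"
    and ab: "b \<le> a" "a \<le> p ^ m"
  shows "[(expl_poly p q m a b :: 'a poly) = gen_poly p q m a b] (mod (monom 1 a))"
proof -
  have char: "CHAR('a) = p" using CHAR_finite_field[where 'a = 'a] p q by blast
  let ?M = "p ^ m - a" and ?d = "a - b"
  let ?I2 = "\<lambda>k i1. {i2. i2 < sigma q k + i1 \<and> (q - 1) dvd (sigma q k + i1 - i2)
               \<and> (q - 1) dvd (tau q k + (?d - i1))}"
  let ?t = "\<lambda>i3 k i1 i2. monom (of_nat (?M choose i3) * of_nat (multinom q a k)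
                 * of_nat (?d choose i1) * of_nat ((sigma q k + i1) choose i2)
                 * (-1) ^ (b + i1 + i3)) (i2 + i3 * (q - 1)) :: 'a poly"
  \<comment> \<open>The exponents on both sides add up to \<open>p ^ m\<close>, and
    \<open>(-1) ^ (p ^ m) = -1\<close> in characteristic \<open>p\<close>, also for
    \<open>p = 2\<close>. As the right-hand sign squares to 1, this determines the left-hand
    one.\<close>
  have sign: "- ((-1) ^ (?M - i3) * (-1) ^ (?d - i1)) = ((-1) ^ (b + i1 + i3) :: 'a)"
    if "i3 \<le> ?M" "i1 \<le> ?d" for i1 i3
  proof -
    have "(-1) ^ (?M - i3 + (?d - i1)) * (-1) ^ (b + i1 + i3) = ((-1) ^ (p ^ m) :: 'a)"
      using that ab by (simp flip: power_add)
    also have "\<dots> = -1"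
      using minus_one_power_prime_power[OF p(1) char, of 0 m] prime_gt_0_nat[OF p(1)] by simp
    finally have uv: "(-1) ^ (?M - i3 + (?d - i1)) * (-1) ^ (b + i1 + i3) = (-1 :: 'a)" .
    have vv: "(-1) ^ (b + i1 + i3) * (-1) ^ (b + i1 + i3) = (1 :: 'a)"
      by (simp flip: power_mult_distrib)
    have "- u = v" if "u * v = -1" "v * v = 1" for u v :: 'a
      using that by (metis mult.assoc mult.right_neutral mult_minus1 minus_minus)
    from this[OF uv vv] show ?thesis by (simp add: power_add)
  qed
  have binom: "(monom 1 (q - 1) - 1 :: 'a poly) ^ ?M
      = (\<Sum>i3=0..?M. monom (of_nat (?M choose i3) * (-1) ^ (?M - i3)) (i3 * (q - 1)))"
  proof -
    have "(monom 1 (q - 1) - 1 :: 'a poly) = monom 1 (q - 1) + [:-1:]" by (simp add: one_pCons)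
    then have "(monom 1 (q - 1) - 1 :: 'a poly) ^ ?M
        = (\<Sum>i\<le>?M. of_nat (?M choose i) * monom 1 (q - 1) ^ i * [:-1:] ^ (?M - i))"
      by (simp only: binomial_ring)
    also have "\<dots> = (\<Sum>i\<le>?M. monom (of_nat (?M choose i) * (-1) ^ (?M - i)) (i * (q - 1)))"
      by (intro sum.cong refl)
         (simp add: poly_const_pow of_nat_poly smult_monom monom_power mult.commute )
    finally show ?thesis by (simp add: atMost_atLeast0)
  qed
  have gen: "gen_poly p q m a b = (\<Sum>i3=0..?M. \<Sum>k\<in>compositions q a. \<Sum>i1=0..?d.
      \<Sum>i2\<in>?I2 k i1. ?t i3 k i1 i2)"
    unfolding gen_poly_def double_sum_expansion[OF q[symmetric]] binom
    unfolding sum_distrib_right unfolding sum_distrib_left sum_negf [symmetric]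
  proof (intro sum.cong refl, goal_cases)
    case (1 i3 k i1 i2)
    then have sg: "(-1) ^ (b + i1 + i3) = - ((-1) ^ (?M - i3) * (-1) ^ (?d - i1) :: 'a)"
      using sign[of i3 i1] by simp
    show ?case unfolding sg by (simp add: mult_monom minus_monom add.commute mult_ac)
  qed
  \<comment> \<open>The bound on the exponent is moved from the index set into an \<open>if\<close>,
    so that the two sums can be compared term by term.\<close>
  have "expl_poly p q m a b = (\<Sum>i3=0..?M. \<Sum>k\<in>compositions q a. \<Sum>i1=0..?d.
      \<Sum>i2\<in>?I2 k i1. if i2 + i3 * (q - 1) < a then ?t i3 k i1 i2 else 0)"
    unfolding expl_poly_def
  proof (rule sum.cong[OF refl], rule sum.cong[OF refl], rule sum.cong[OF refl], goal_cases)
    case (1 i3 k i1)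
    show ?case
      by (subst sum.inter_filter [symmetric]) (auto intro!: sum.cong)
  qed
  then show ?thesis
    unfolding gen by (simp only:) (intro cong_sum, auto simp: cong_iff_dvd_diff monom_1_dvd_iff')
qed

section \<open>Polynomials invariant under all shifts\<close>

lemma pcompose_power: "pcompose (p ^ n) r = pcompose p r ^ n"
  by (induction n) (auto simp: pcompose_mult pcompose_1)

text \<open>Orders of vanishing at \<open>c\<close> add under multiplication, and \<open>D\<close>
  has order 0 there.\<close>

lemma linear_power_dvd_cancel:
  fixes D E :: "'a::field poly"
  assumes "[:-c, 1:] ^ n dvd D * E" "poly D c \<noteq> 0"
  shows "[:-c, 1:] ^ n dvd E"
proof (cases "E = 0")
  case False
  have "D \<noteq> 0" using assms(2) by auto
  with False have "n \<le> order c (D * E)" using assms(1) by (auto simp: order_divides)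
  also have "\<dots> = order c E"
    using False \<open>D \<noteq> 0\<close> assms(2) by (simp add: order_mult order_0I)
  finally show ?thesis using False by (simp add: order_divides)
qed simp

lemma prod_linear_power_dvd:
  fixes D :: "'a::field poly"
  assumes "finite S" "\<And>c. c \<in> S \<Longrightarrow> [:-c, 1:] ^ n dvd D"
  shows "(\<Prod>c\<in>S. [:-c, 1:] ^ n) dvd D"
  using assms
proof (induction S rule: finite_induct)
  case (insert c S)
  then obtain E where E: "D = (\<Prod>c\<in>S. [:-c, 1:] ^ n) * E" by (auto elim!: dvdE)
  have "[:-c, 1:] ^ n dvd E"
  proof (rule linear_power_dvd_cancel)
    show "[:-c, 1:] ^ n dvd (\<Prod>c\<in>S. [:-c, 1:] ^ n) * E" using insert.prems E by auto
    show "poly (\<Prod>c\<in>S. [:-c, 1:] ^ n) c \<noteq> 0"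
      using insert.hyps by (auto simp: poly_prod)
  qed
  then show ?case using insert.hyps E by (simp add: mult.commute mult_dvd_mono)
qed simp

text \<open>Invariance carries the zero of order \<open>n\<close> at 0 to every field element. A
  nonzero \<open>D\<close> would thus be divisible by a product of degree \<open>q * n\<close>, more
  than its own degree.\<close>

lemma shift_invariant_eq_0:
  fixes D :: "'a::finite_field poly"
  assumes inv: "\<And>c. pcompose D [:c, 1:] = D"
    and dvd: "[:0, 1:] ^ n dvd D"
    and deg: "degree D < card (UNIV :: 'a set) * n"
  shows "D = 0"
proof (rule ccontr)
  assume "D \<noteq> 0"
  have "[:-c, 1:] ^ n dvd D" for c
  proof -
    from dvd obtain E where "D = [:0, 1:] ^ n * E" by (auto elim: dvdE)
    then have "pcompose D [:-c, 1:] = [:-c, 1:] ^ n * pcompose E [:-c, 1:]"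
      by (simp add: pcompose_mult pcompose_power pcompose_pCons)
    then show ?thesis by (simp add: inv)
  qed
  then have "(\<Prod>c\<in>UNIV. [:-c, 1:] ^ n) dvd D" by (intro prod_linear_power_dvd) auto
  then have "degree (\<Prod>c\<in>(UNIV :: 'a set). [:-c, 1:] ^ n) \<le> degree D"
    using \<open>D \<noteq> 0\<close> by (rule dvd_imp_degree_le)
  also have "degree (\<Prod>c\<in>(UNIV :: 'a set). [:-c, 1:] ^ n) = card (UNIV :: 'a set) * n"
    by (subst degree_prod_eq_sum_degree) (auto simp: degree_power_eq)
  finally show False using deg by simp
qed

section \<open>\<open>S1\<close> and \<open>Delta\<close> as sums over the field, and the factors of
  \<open>t^q - t\<close>\<close>

lemma S1_eq: "S1 k = (\<Sum>\<theta>\<in>(UNIV :: 'a::finite_field set). to_fract [:\<theta>, 1:] powi (- k))"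
proof -
  have "n = [:coeff n 0, 1:]" if "lead_coeff n = 1" "degree n = 1" for n :: "'a poly"
    using that by (intro poly_eqI) (auto simp: coeff_pCons coeff_eq_0 split: nat.split)
  then have "{n :: 'a poly. lead_coeff n = 1 \<and> degree n = 1} = (\<lambda>\<theta>. [:\<theta>, 1:]) ` UNIV"
    unfolding image_def by (intro set_eqI iffI) (blast, auto)
  moreover have "inj (\<lambda>\<theta>::'a. [:\<theta>, 1:])" by (auto simp: inj_def)
  ultimately show ?thesis by (simp add: S1_def sum.reindex)
qed

text \<open>In the product of the two sums put \<open>\<eta> = \<theta> - \<mu>\<close>; the
  diagonal part \<open>\<mu> = 0\<close> is exactly \<open>S1 (a + b)\<close>.\<close>

lemma Delta_eq:
  "Delta a b = (\<Sum>\<theta>\<in>(UNIV :: 'a::finite_field set). \<Sum>\<mu>\<in>UNIV - {0}.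
      inverse (to_fract [:\<theta>, 1:] ^ a * to_fract [:\<theta> - \<mu>, 1:] ^ b))"
proof -
  let ?x = "\<lambda>\<theta>::'a. to_fract [:\<theta>, 1:]"
  have S1: "S1 (int n) = (\<Sum>\<theta>\<in>(UNIV :: 'a set). inverse (?x \<theta> ^ n))" for n
    unfolding S1_eq by (simp add: power_int_minus)
  have "S1 (int a) * S1 (int b)
      = (\<Sum>\<theta>\<in>(UNIV :: 'a set). \<Sum>\<eta>\<in>UNIV. inverse (?x \<theta> ^ a * ?x \<eta> ^ b))"
    unfolding S1 sum_product by (simp add: mult.commute)
  also have "\<dots> = (\<Sum>\<theta>\<in>(UNIV :: 'a set). \<Sum>\<mu>\<in>UNIV. inverse (?x \<theta> ^ a * ?x (\<theta> - \<mu>) ^ b))"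
  proof (rule sum.cong[OF refl])
    fix \<theta> :: 'a
    show "(\<Sum>\<eta>\<in>UNIV. inverse (?x \<theta> ^ a * ?x \<eta> ^ b)) = (\<Sum>\<mu>\<in>UNIV. inverse (?x \<theta> ^ a * ?x (\<theta> - \<mu>) ^ b))"
      by (rule sum.reindex_bij_witness[of _ "\<lambda>\<mu>. \<theta> - \<mu>" "\<lambda>\<eta>. \<theta> - \<eta>"]) auto
  qed
  also have "\<dots> = (\<Sum>\<theta>\<in>(UNIV :: 'a set). inverse (?x \<theta> ^ (a + b))
      + (\<Sum>\<mu>\<in>UNIV - {0}. inverse (?x \<theta> ^ a * ?x (\<theta> - \<mu>) ^ b)))"
    by (intro sum.cong refl, subst sum.remove[of UNIV 0]) (auto simp: power_add)
  also have "\<dots> = S1 (int (a + b)) + (\<Sum>\<theta>\<in>(UNIV :: 'a set). \<Sum>\<mu>\<in>UNIV - {0}.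
      inverse (?x \<theta> ^ a * ?x (\<theta> - \<mu>) ^ b))"
    unfolding S1 by (rule sum.distrib)
  finally show ?thesis by (simp add: Delta_def)
qed

text \<open>Both sides are \<open>t^q - t\<close>: by Frobenius
  \<open>(t + \<theta>)^q = t^q + \<theta>^q\<close>, and
  \<open>\<theta>^q = \<theta>\<close>.\<close>

lemma linear_mult_power_minus_1:
  fixes \<theta> :: "'a::finite_field"
  assumes p: "prime p" "q = p ^ s" and q: "q = card (UNIV :: 'a set)"
  shows "[:\<theta>, 1:] * ([:\<theta>, 1:] ^ (q - 1) - 1) = [:0, 1:] * (monom 1 (q - 1) - 1)"
proof -
  have q1: "q > 1" using card_finite_field_gt_1[where 'a = 'a] q by simp
  have "[:\<theta>, 1:] ^ q = [:0, 1:] ^ q + [:\<theta>:]"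
  proof -
    have "([:0, 1:] + [:\<theta>:]) ^ q = [:0, 1:] ^ q + [:\<theta>:] ^ q"
      by (rule freshmans_dream'[of _ s]) (use p CHAR_finite_field[OF p(1), where 'a = 'a] q in auto)
    then show ?thesis by (simp add: poly_const_pow q finite_field_power_card_eq_same)
  qed
  moreover have "x * (x ^ (q - 1) - 1) = x ^ q - x" for x :: "'a poly"
    using q1 by (simp add: right_diff_distrib power_eq_if)
  ultimately show ?thesis by (simp add: monom_altdef)
qed

text \<open>This is the factorization of \<open>x^n - y^n\<close> with \<open>n = q - 1\<close>,
  \<open>x = t + \<theta>\<close> and \<open>y = \<mu>\<close>, where
  \<open>\<mu>^(q-1) = 1\<close>.\<close>

lemma geometric_sum_smult:
  fixes \<mu> :: "'a::finite_field"
  assumes q: "q = card (UNIV :: 'a set)" and "\<mu> \<noteq> 0"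
  shows "[:\<theta> - \<mu>, 1:] * (\<Sum>j=1..q-1. smult (\<mu> ^ (q - 1 - j)) ([:\<theta>, 1:] ^ (j - 1)))
    = [:\<theta>, 1:] ^ (q - 1) - 1"
proof -
  have "(\<Sum>j=1..q-1. smult (\<mu> ^ (q - 1 - j)) ([:\<theta>, 1:] ^ (j - 1)))
      = (\<Sum>i<q-1. [:\<mu>:] ^ (q - 1 - Suc i) * [:\<theta>, 1:] ^ i)"
    by (rule sum.reindex_bij_witness[of _ Suc "\<lambda>j. j - 1"]) (auto simp: poly_const_pow)
  then have "([:\<theta>, 1:] - [:\<mu>:]) * (\<Sum>j=1..q-1. smult (\<mu> ^ (q - 1 - j)) ([:\<theta>, 1:] ^ (j - 1)))
      = [:\<theta>, 1:] ^ (q - 1) - [:\<mu>:] ^ (q - 1)"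
    by (simp only: power_diff_sumr2)
  also have "[:\<mu>:] ^ (q - 1) = 1"
    unfolding poly_const_pow q finite_field_power_card_minus_1[OF assms(2)] by (simp add: one_pCons)
  finally show ?thesis by simp
qed

section \<open>The formula for \<open>Delta\<close> by clearing denominators\<close>

lemma to_fract_power [simp]: "to_fract (x ^ n) = to_fract x ^ n"
  by (induction n) auto

lemma degree_power_le_mult:
  assumes "degree p \<le> n"
  shows "degree (p ^ k) \<le> n * k"
  using degree_power_le[of p k] mult_le_mono1[OF assms] by (rule order.trans)

lemma Delta_eq_sum_S1:
  fixes p s q a b m :: nat and f :: "'a::finite_field poly"
  assumes p: "prime p" "q = p ^ s" and q: "q = card (UNIV :: 'a set)"
    and ab: "1 \<le> b" "b \<le> a" "a \<le> p ^ m"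
    and f: "degree f < a" "[f = gen_poly p q m a b] (mod (monom 1 a))"
  shows "Delta a b = (\<Sum>i=0..a-1. to_fract [:coeff f i:] * S1 (int a - int i))"
proof -
  \<comment> \<open>Here \<open>Q \<theta>\<close> is the cofactor of \<open>X \<theta>\<close> in
    \<open>P = t^q - t\<close>, and \<open>R \<theta> \<mu>\<close> is the cofactor of
    \<open>X (\<theta> - \<mu>)\<close> in \<open>Q \<theta>\<close> for nonzero \<mu>. Then
    \<open>G\<close> is \<open>P ^ a\<close> times \<open>Delta a b\<close>, and \<open>H\<close> is
    \<open>P ^ a\<close> times the right-hand side of the claim.\<close>
  define X :: "'a \<Rightarrow> 'a poly" where "X \<theta> = [:\<theta>, 1:]" for \<theta>
  define Q where "Q \<theta> = X \<theta> ^ (q - 1) - 1" for \<theta>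
  define P where "P = X 0 * Q 0"
  define R where "R \<theta> \<mu> = (\<Sum>j=1..q-1. smult (\<mu> ^ (q - 1 - j)) (X \<theta> ^ (j - 1)))" for \<theta> \<mu>
  define G where "G = (\<Sum>\<theta>\<in>UNIV. \<Sum>\<mu>\<in>UNIV - {0}. R \<theta> \<mu> ^ a * X (\<theta> - \<mu>) ^ (a - b))"
  define H where "H = (\<Sum>i=0..a-1. smult (coeff f i) (P ^ i * (\<Sum>\<theta>\<in>UNIV. Q \<theta> ^ (a - i))))"
  have q1: "q > 1" using card_finite_field_gt_1[where 'a = 'a] q by simp
  have XQ: "X \<theta> * Q \<theta> = P" for \<theta>
    using linear_mult_power_minus_1[OF p q, of \<theta>] linear_mult_power_minus_1[OF p q, of 0]
    by (simp add: P_def Q_def X_def)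
  have YR: "X (\<theta> - \<mu>) * R \<theta> \<mu> = Q \<theta>" if "\<mu> \<noteq> 0" for \<theta> \<mu>
    using geometric_sum_smult[OF q that] by (simp add: X_def R_def Q_def)
  have gen: "gen_poly p q m a b = - (Q 0 ^ (p ^ m - a) * G)"
    by (simp add: gen_poly_def Q_def X_def G_def R_def monom_altdef)
  have t: "monom 1 n = X 0 ^ n" for n by (simp add: X_def monom_altdef)

  have "G - H = 0"
  proof (rule shift_invariant_eq_0)
    fix c
    have X: "pcompose (X \<theta>) [:c, 1:] = X (\<theta> + c)" for \<theta>
      by (simp add: X_def pcompose_pCons)
    have Q: "pcompose (Q \<theta>) [:c, 1:] = Q (\<theta> + c)" for \<theta>
      by (simp add: Q_def pcompose_diff pcompose_power X pcompose_1)
    have P: "pcompose P [:c, 1:] = P"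
      unfolding P_def pcompose_mult X Q using XQ[of c] by (simp add: P_def)
    have R: "pcompose (R \<theta> \<mu>) [:c, 1:] = R (\<theta> + c) \<mu>" for \<theta> \<mu>
      by (simp add: R_def pcompose_sum pcompose_smult pcompose_power X)
    have "pcompose G [:c, 1:] = (\<Sum>\<theta>\<in>UNIV. \<Sum>\<mu>\<in>UNIV - {0}. R (\<theta> + c) \<mu> ^ a * X (\<theta> + c - \<mu>) ^ (a - b))"
      by (simp add: G_def pcompose_sum pcompose_mult pcompose_power R X algebra_simps)
    also have "\<dots> = G" unfolding G_def
      by (rule sum.reindex_bij_witness[of _ "\<lambda>\<theta>. \<theta> - c" "\<lambda>\<theta>. \<theta> + c"]) auto
    finally have G: "pcompose G [:c, 1:] = G" .
    have "(\<Sum>\<theta>\<in>UNIV. Q (\<theta> + c) ^ n) = (\<Sum>\<theta>\<in>UNIV. Q \<theta> ^ n)" for n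
      by (rule sum.reindex_bij_witness[of _ "\<lambda>\<theta>. \<theta> - c" "\<lambda>\<theta>. \<theta> + c"]) auto
    then have "pcompose H [:c, 1:] = H"
      by (simp add: H_def pcompose_sum pcompose_mult pcompose_power pcompose_smult Q P)
    with G show "pcompose (G - H) [:c, 1:] = G - H" by (simp add: pcompose_diff)
  next
    have "[H = (\<Sum>i=0..a-1. smult (coeff f i) (X 0 ^ i * Q 0 ^ a))] (mod X 0 ^ a)"
      unfolding H_def
    proof (intro cong_sum)
      fix i assume i: "i \<in> {0..a-1}"
      then have ia: "i < a" using ab by auto
      \<comment> \<open>Modulo \<open>t^a\<close> only \<open>\<theta> = 0\<close> contributes: for
        every other \<theta> both \<open>P\<close> and \<open>Q \<theta>\<close> vanish at 0, which
        yields \<open>i + (a - i)\<close> factors \<open>t\<close>.\<close>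
      have "P ^ i * (\<Sum>\<theta>\<in>UNIV. Q \<theta> ^ (a - i)) - X 0 ^ i * Q 0 ^ a
          = (\<Sum>\<theta>\<in>UNIV - {0}. P ^ i * Q \<theta> ^ (a - i))"
        using ia by (subst sum.remove[of UNIV 0])
          (auto simp: P_def power_mult_distrib distrib_left sum_distrib_left mult_ac simp flip: power_add)
      moreover have "X 0 ^ a dvd P ^ i * Q \<theta> ^ (a - i)" if "\<theta> \<noteq> 0" for \<theta>
      proof -
        have "poly (Q \<theta>) 0 = 0"
          using finite_field_power_card_minus_1[OF that] by (simp add: Q_def X_def q)
        then have "X 0 dvd Q \<theta>" by (simp add: X_def poly_eq_0_iff_dvd)
        moreover have "X 0 dvd P" by (simp add: P_def)
        ultimately have "X 0 ^ i * X 0 ^ (a - i) dvd P ^ i * Q \<theta> ^ (a - i)"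
          by (intro mult_dvd_mono dvd_power_same)
        then show ?thesis using ia by (simp flip: power_add)
      qed
      ultimately have "X 0 ^ a dvd P ^ i * (\<Sum>\<theta>\<in>UNIV. Q \<theta> ^ (a - i)) - X 0 ^ i * Q 0 ^ a"
        by (auto intro: dvd_sum)
      then show "[smult (coeff f i) (P ^ i * (\<Sum>\<theta>\<in>UNIV. Q \<theta> ^ (a - i)))
          = smult (coeff f i) (X 0 ^ i * Q 0 ^ a)] (mod X 0 ^ a)"
        by (simp add: cong_iff_dvd_diff dvd_smult flip: smult_diff_right)
    qed
    also have "(\<Sum>i=0..a-1. smult (coeff f i) (X 0 ^ i * Q 0 ^ a)) = f * Q 0 ^ a"
    proof -
      have "f = (\<Sum>i\<le>a-1. monom (coeff f i) i)"
        using f(1) by (intro poly_as_sum_of_monoms'[symmetric]) auto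
      also have "\<dots> = (\<Sum>i=0..a-1. smult (coeff f i) (X 0 ^ i))"
        by (simp add: t[symmetric] smult_monom atMost_atLeast0)
      finally have "f * Q 0 ^ a = (\<Sum>i=0..a-1. smult (coeff f i) (X 0 ^ i)) * Q 0 ^ a"
        by (rule arg_cong)
      then show ?thesis by (simp only: sum_distrib_right mult_smult_left)
    qed
    \<comment> \<open>The multiplier completes \<open>Q 0 ^ a\<close> to
      \<open>Q 0 ^ (p ^ m) = t^((q-1) p^m) - 1\<close>. This is -1 modulo \<open>t^a\<close> because
      \<open>(q - 1) * p ^ m\<close> is at least \<open>a\<close>, so the right-hand side reduces to
      \<open>f\<close>.\<close>
    finally have "[- (Q 0 ^ (p ^ m - a) * H) = - (Q 0 ^ (p ^ m - a) * (f * Q 0 ^ a))] (mod X 0 ^ a)"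
      by (intro cong_minus_minus_iff[THEN iffD2] cong_mult cong_refl)
    also have "- (Q 0 ^ (p ^ m - a) * (f * Q 0 ^ a)) = - f * Q 0 ^ (p ^ m)"
      using ab by (simp add: mult_ac flip: power_add)
    also have "Q 0 ^ (p ^ m) = (X 0 ^ (q - 1)) ^ (p ^ m) - 1"
      unfolding Q_def by (rule minus_one_power_prime_power[OF p(1)])
        (use CHAR_finite_field[OF p(1), where 'a = 'a] p q in auto)
    also have "- f * \<dots> = f - f * X 0 ^ ((q - 1) * p ^ m)"
      by (simp add: algebra_simps flip: power_mult)
    also have "[\<dots> = f] (mod X 0 ^ a)"
    proof -
      have "1 * a \<le> (q - 1) * p ^ m" using q1 ab by (intro mult_mono) auto
      then show ?thesis by (simp add: cong_iff_dvd_diff le_imp_power_dvd)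
    qed
    also have "[f = - (Q 0 ^ (p ^ m - a) * G)] (mod X 0 ^ a)"
      using f(2) by (simp add: gen t)
    finally have "X 0 ^ a dvd Q 0 ^ (p ^ m - a) * (G - H)"
      by (simp add: cong_iff_dvd_diff right_diff_distrib)
    \<comment> \<open>The constant term of \<open>Q 0\<close> is -1, so its power can be cancelled
      from the divisibility by \<open>t^a\<close>.\<close>
    moreover have "poly (Q 0 ^ (p ^ m - a)) 0 \<noteq> 0"
      using q1 by (simp add: Q_def X_def power_0_left)
    ultimately show "[:0, 1:] ^ a dvd G - H"
      using linear_power_dvd_cancel[of 0 a "Q 0 ^ (p ^ m - a)" "G - H"] by (simp add: X_def)
  next
    have degX: "degree (X \<theta> ^ n) = n" for \<theta> n by (simp add: X_def degree_power_eq)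
    have degQ: "degree (Q \<theta>) \<le> q - 1" for \<theta>
      unfolding Q_def by (intro degree_diff_le) (auto simp: degX)
    have degP: "degree P \<le> q"
      unfolding P_def using degQ[of 0] degX[of 0 1] q1
      by (intro order.trans[OF degree_mult_le]) auto
    have degR: "degree (R \<theta> \<mu>) \<le> q - 2" for \<theta> \<mu>
      unfolding R_def
      by (intro degree_sum_le order.trans[OF degree_smult_le]) (auto simp: degX)
    have a0: "a > 0" using ab by simp
    have "degree G < q * a"
      unfolding G_def
    proof (intro degree_sum_less)
      fix \<theta> \<mu> :: 'a
      have "degree (R \<theta> \<mu> ^ a * X (\<theta> - \<mu>) ^ (a - b)) \<le> degree (R \<theta> \<mu> ^ a) + (a - b)"
        using degree_mult_le[of "R \<theta> \<mu> ^ a" "X (\<theta> - \<mu>) ^ (a - b)"] by (simp add: degX)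
      also have "degree (R \<theta> \<mu> ^ a) \<le> (q - 2) * a"
        by (rule degree_power_le_mult[OF degR])
      \<comment> \<open>Splitting \<open>q\<close> into \<open>q - 2\<close> and 2 gives strictness
        from \<open>a - b < 2 * a\<close>, which holds as \<open>a\<close> is positive.\<close>
      also have "(q - 2) * a + (a - b) < (q - 2) * a + 2 * a" using ab by simp
      also have "\<dots> = (q - 2 + 2) * a" by (simp only: add_mult_distrib)
      also have "q - 2 + 2 = q" using q1 by simp
      finally show "degree (R \<theta> \<mu> ^ a * X (\<theta> - \<mu>) ^ (a - b)) < q * a" by simp
    qed (use q1 a0 in auto)
    moreover have "degree H < q * a"
      unfolding H_def
    proof (intro degree_sum_less)
      fix i assume "i \<in> {0..a-1}"
      then have ia: "i < a" using a0 by auto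
      let ?S = "\<Sum>\<theta>\<in>UNIV. Q \<theta> ^ (a - i)"
      have "degree ?S \<le> (q - 1) * (a - i)"
        by (intro degree_sum_le degree_power_le_mult degQ) simp
      moreover have "degree (P ^ i) \<le> q * i"
        by (rule degree_power_le_mult[OF degP])
      ultimately have "degree (smult (coeff f i) (P ^ i * ?S)) \<le> q * i + (q - 1) * (a - i)"
        by (meson add_mono degree_mult_le degree_smult_le order.trans)
      \<comment> \<open>Strict because \<open>a - i\<close> is positive: every
        \<open>S1 (a - i)\<close> on the right has a positive argument.\<close>
      also have "\<dots> < q * i + q * (a - i)" using ia q1 by simp
      also have "\<dots> = q * a" using ia by (simp flip: add_mult_distrib2)
      finally show "degree (smult (coeff f i) (P ^ i * ?S)) < q * a" .
    qed (use q1 a0 in auto)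
    ultimately show "degree (G - H) < card (UNIV :: 'a set) * a"
      using q by (simp add: degree_diff_less)
  qed
  then have GH: "G = H" by simp

  have X0: "to_fract (X \<theta>) \<noteq> 0" for \<theta> by (simp add: X_def)
  have "Q 0 \<noteq> 0"
  proof
    assume "Q 0 = 0"
    then have "poly (Q 0) 0 = 0" by simp
    then show False using q1 by (simp add: Q_def X_def power_0_left)
  qed
  then have P0: "to_fract P \<noteq> 0" by (simp add: P_def X_def)
  \<comment> \<open>Since \<open>P = X \<theta> * X (\<theta> - \<mu>) * R \<theta> \<mu>\<close>,
    multiplying by \<open>P ^ a\<close> clears the denominator and leaves \<open>a - b\<close>
    factors \<open>X (\<theta> - \<mu>)\<close>.\<close>
  have "to_fract P ^ a * Delta a b = to_fract G"
    unfolding Delta_eq G_def sum_distrib_left to_fract_sum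
  proof (intro sum.cong refl)
    fix \<theta> \<mu> :: 'a assume "\<mu> \<in> UNIV - {0}"
    then have "P = X \<theta> * X (\<theta> - \<mu>) * R \<theta> \<mu>" using XQ[of \<theta>] YR[of \<mu> \<theta>] by (simp add: mult_ac)
    then have "to_fract P ^ a = to_fract (X \<theta>) ^ a * to_fract (X (\<theta> - \<mu>)) ^ b
        * to_fract (R \<theta> \<mu> ^ a * X (\<theta> - \<mu>) ^ (a - b))"
      using ab by (simp add: power_mult_distrib mult_ac flip: power_add)
    then show "to_fract P ^ a * inverse (to_fract [:\<theta>, 1:] ^ a * to_fract [:\<theta> - \<mu>, 1:] ^ b)
        = to_fract (R \<theta> \<mu> ^ a * X (\<theta> - \<mu>) ^ (a - b))"
      using X0[of \<theta>] X0[of "\<theta> - \<mu>"] by (simp add: X_def field_simps)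
  qed
  also have "\<dots> = to_fract P ^ a * (\<Sum>i=0..a-1. to_fract [:coeff f i:] * S1 (int a - int i))"
    unfolding GH H_def sum_distrib_left[of "to_fract P ^ a"] to_fract_sum
  proof (intro sum.cong refl)
    fix i assume "i \<in> {0..a-1}"
    then have ia: "i < a" using ab by auto
    then have n: "int a - int i = int (a - i)" by simp
    \<comment> \<open>Of the \<open>a\<close> factors \<open>P\<close>, the denominator turns
      \<open>a - i\<close> into \<open>Q \<theta>\<close> and leaves the other \<open>i\<close>
      unchanged.\<close>
    have Qe: "to_fract P ^ i * to_fract (Q \<theta>) ^ (a - i) = to_fract P ^ a * inverse (to_fract (X \<theta>) ^ (a - i))"
      for \<theta>
    proof -
      have "to_fract P ^ a = to_fract P ^ i * to_fract P ^ (a - i)"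
        using ia by (simp flip: power_add)
      also have "to_fract P ^ (a - i) = to_fract (X \<theta>) ^ (a - i) * to_fract (Q \<theta>) ^ (a - i)"
        by (simp flip: XQ[of \<theta>] power_mult_distrib)
      finally show ?thesis using X0[of \<theta>] by (simp add: field_simps)
    qed
    have "S1 (int a - int i) = (\<Sum>\<theta>\<in>UNIV. inverse (to_fract (X \<theta>) ^ (a - i)))"
      unfolding n S1_eq by (simp add: X_def power_int_minus)
    then have "to_fract P ^ a * S1 (int a - int i) = to_fract (P ^ i * (\<Sum>\<theta>\<in>UNIV. Q \<theta> ^ (a - i)))"
      by (simp only: to_fract_mult to_fract_sum to_fract_power sum_distrib_left Qe)
    moreover have "to_fract (smult (coeff f i) g) = to_fract [:coeff f i:] * to_fract g" for g
      by (simp flip: to_fract_mult)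
    ultimately show "to_fract (smult (coeff f i) (P ^ i * (\<Sum>\<theta>\<in>UNIV. Q \<theta> ^ (a - i))))
        = to_fract P ^ a * (to_fract [:coeff f i:] * S1 (int a - int i))"
      by (simp only: mult.left_commute[of "to_fract P ^ a"])
  qed
  finally show ?thesis using P0 by simp
qed

section \<open>Existence, uniqueness and explicit form of the polynomial\<close>

theorem theorem6p3:
  fixes p s q a b m :: nat
  assumes "prime p"
    and "q = p ^ s"
    and "card (UNIV :: 'a::finite_field set) = q"
    and "b \<ge> 1" and "a \<ge> b"
    and "m = (LEAST m. a \<le> p ^ m)"
  shows "(\<exists>!f :: 'a poly. f \<in> prime_subfield_polys \<and> degree f < a
             \<and> [f = gen_poly p q m a b] (mod (monom 1 a)))
       \<and> (\<forall>f :: 'a poly. f \<in> prime_subfield_polys \<and> degree f < a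
             \<and> [f = gen_poly p q m a b] (mod (monom 1 a)) \<longrightarrow>
            Delta a b = (\<Sum>i=0..a-1. to_fract [:coeff f i:] * S1 (int a - int i))
          \<and> f = expl_poly p q m a b)"
proof -
  \<comment> \<open>Some power of \<open>p\<close> reaches \<open>a\<close>, so the
    \<open>LEAST\<close> in the hypothesis is attained.\<close>
  have "\<exists>m. a \<le> p ^ m"
    using prime_gt_1_nat[OF assms(1)] by (metis less_exp less_imp_le order.trans power_mono
        Suc_1 Suc_leI zero_le)
  then have am: "a \<le> p ^ m" unfolding assms(6) by (rule LeastI_ex)
  \<comment> \<open>The explicit polynomial is the witness for existence: its coefficients come from
    integers, its degree is below \<open>a\<close>, and it lies in the right residue class. Two such
    representatives differ by a multiple of \<open>t^a\<close> of degree below \<open>a\<close>,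
    hence coincide.\<close>
  let ?e = "expl_poly p q m a b :: 'a poly"
  have cong: "[?e = gen_poly p q m a b] (mod (monom 1 a))"
    using gen_poly_cong_expl_poly assms am by blast
  have "coeff ?e i \<in> \<int>" for i
    unfolding expl_poly_def coeff_sum by (auto intro!: Ints_sum Ints_mult Ints_power)
  then have sub: "?e \<in> prime_subfield_polys" by (simp add: prime_subfield_polys_def)
  have deg: "degree ?e < a"
    unfolding expl_poly_def using assms(4,5)
    by (intro degree_sum_less) (auto intro: le_less_trans[OF degree_monom_le])
  have uniq: "f = ?e" if "degree f < a" "[f = gen_poly p q m a b] (mod (monom 1 a))" for f :: "'a poly"
  proof -
    have "[f = ?e] (mod (monom 1 a))" using that(2) cong by (simp add: cong_def)
    then have "monom 1 a dvd f - ?e" by (simp add: cong_iff_dvd_diff)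
    moreover have "degree (f - ?e) < degree (monom 1 a :: 'a poly)"
      using that(1) deg by (simp add: degree_monom_eq degree_diff_less)
    ultimately have "f - ?e = 0" using dvd_imp_degree_le by (metis not_le)
    then show ?thesis by simp
  qed
  show ?thesis
    using sub deg cong uniq Delta_eq_sum_S1[OF assms(1,2) assms(3)[symmetric] assms(4,5) am]
    by blast
qed

end
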